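(* There exists an absolute numerical constant $C>0$ such that the following holds. Let $f:\mathbb{R}^d\to\mathbb{R}$ be $\mu$-strongly convex with $\mu>0$, $L$-smooth and $(L_0,L_1)$-smooth, and let $\mathbf{x}^\star=\arg\min_{\mathbf{x}}f(\mathbf{x})$. Let $c>0$, $0<\eta\le (L_0+cL_1)^{-1}$, $\mathbf{x}_0\in\mathbb{R}^d$ with $\mathbf{x}_0\neq\mathbf{x}^\star$, let $\mathbf{x}_{t+1}=\mathbf{x}_t-\eta\,\mathrm{clip}_c(\nabla f(\mathbf{x}_t))$ for $t\ge0$ be the iterates of clipped gradient descent with deterministic gradients, and set $R_t^2=\|\mathbf{x}_t-\mathbf{x}^\star\|^2$ (with $R_t\ge 0$). Then for every target accuracy $\epsilon>0$, one has $R_T^2\le\epsilon$ for every integer $T\ge 0$ with $$T\;\ge\; C\left(\frac{1}{\mu\eta}\log\Big(\frac{R_0^2}{\epsilon}\Big)+\frac{R_0}{c\,\eta}\min\Big(\sqrt{\frac{L}{\mu}},\,\frac{LR_0}{c}\Big)\right).$$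
   Context: $\|\cdot\|$ is the Euclidean norm. $L$-smoothness: $f$ is differentiable and $\|\nabla f(\mathbf{x})-\nabla f(\mathbf{y})\|\le L\|\mathbf{x}-\mathbf{y}\|$ for all $\mathbf{x},\mathbf{y}\in\mathbb{R}^d$. $(L_0,L_1)$-smoothness, for constants $L_0,L_1\ge 0$: $f$ is differentiable and $\|\nabla f(\mathbf{x})-\nabla f(\mathbf{y})\|\le (L_0+L_1\|\nabla f(\mathbf{x})\|)\,\|\mathbf{x}-\mathbf{y}\|$ for all $\mathbf{x},\mathbf{y}\in\mathbb{R}^d$ with $\|\mathbf{x}-\mathbf{y}\|\le 1/L_1$ (with $1/L_1=+\infty$ if $L_1=0$). $\mu$-strong convexity: $f(\mathbf{x})-f(\mathbf{y})+\frac{\mu}{2}\|\mathbf{x}-\mathbf{y}\|^2\le\langle\nabla f(\mathbf{x}),\mathbf{x}-\mathbf{y}\rangle$ for all $\mathbf{x},\mathbf{y}\in\mathbb{R}^d$. Clipping operator: $\mathrm{clip}_c(\mathbf{u})=\min\big(1,\frac{c}{\|\mathbf{u}\|}\big)\mathbf{u}$ (with $\mathrm{clip}_c(0)=0$). *)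

theory Defs
  imports Complex_Main "Jordan_Normal_Form.Matrix"
begin

text \<open>
  The constant in the theorem must not depend on the dimension, so \<open>d\<close> has to be quantified
  inside the existential over that constant. It therefore cannot be the size of an index type;
  \<open>\<real>^d\<close> is \<^term>\<open>carrier_vec d :: real vec set\<close>, and a function on \<open>\<real>^d\<close> is a
  function on \<^typ>\<open>real vec\<close> of which only the values on this carrier matter.
\<close>

definition euclid_norm :: "real vec \<Rightarrow> real" where
  "euclid_norm v = sqrt (v \<bullet> v)"

text \<open>Frechet differentiability at \<open>x\<close>, with the derivative represented by the vector \<open>g\<close>;
  \<^typ>\<open>real vec\<close> is not a normed space as a type, so \<^const>\<open>has_derivative\<close> does not apply.\<close>

definition has_gradient :: "nat \<Rightarrow> (real vec \<Rightarrow> real) \<Rightarrow> real vec \<Rightarrow> real vec \<Rightarrow> bool" where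
  "has_gradient d f g x \<longleftrightarrow> g \<in> carrier_vec d \<and>
     (\<forall>e>0. \<exists>\<delta>>0. \<forall>y\<in>carrier_vec d. euclid_norm (y - x) < \<delta> \<longrightarrow>
        \<bar>f y - f x - g \<bullet> (y - x)\<bar> \<le> e * euclid_norm (y - x))"

definition differentiable_vec :: "nat \<Rightarrow> (real vec \<Rightarrow> real) \<Rightarrow> bool" where
  "differentiable_vec d f \<longleftrightarrow> (\<forall>x\<in>carrier_vec d. \<exists>g. has_gradient d f g x)"

definition gradient :: "nat \<Rightarrow> (real vec \<Rightarrow> real) \<Rightarrow> real vec \<Rightarrow> real vec" where
  "gradient d f x = (THE g. has_gradient d f g x)"

definition L_smooth :: "nat \<Rightarrow> real \<Rightarrow> (real vec \<Rightarrow> real) \<Rightarrow> bool" where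
  "L_smooth d L f \<longleftrightarrow> differentiable_vec d f \<and>
     (\<forall>x\<in>carrier_vec d. \<forall>y\<in>carrier_vec d.
        euclid_norm (gradient d f x - gradient d f y) \<le> L * euclid_norm (x - y))"

text \<open>The disjunct \<open>L1 = 0\<close> is the convention \<open>1 / 0 = \<infinity>\<close> for the radius.\<close>

definition L0_L1_smooth :: "nat \<Rightarrow> real \<Rightarrow> real \<Rightarrow> (real vec \<Rightarrow> real) \<Rightarrow> bool" where
  "L0_L1_smooth d L0 L1 f \<longleftrightarrow> L0 \<ge> 0 \<and> L1 \<ge> 0 \<and> differentiable_vec d f \<and>
     (\<forall>x\<in>carrier_vec d. \<forall>y\<in>carrier_vec d.
        L1 = 0 \<or> euclid_norm (x - y) \<le> 1 / L1 \<longrightarrow>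
        euclid_norm (gradient d f x - gradient d f y)
          \<le> (L0 + L1 * euclid_norm (gradient d f x)) * euclid_norm (x - y))"

text \<open>Meaningful for differentiable \<open>f\<close> only; differentiability is part of the smoothness notions.\<close>

definition strongly_convex :: "nat \<Rightarrow> real \<Rightarrow> (real vec \<Rightarrow> real) \<Rightarrow> bool" where
  "strongly_convex d \<mu> f \<longleftrightarrow>
     (\<forall>x\<in>carrier_vec d. \<forall>y\<in>carrier_vec d.
        f x - f y + \<mu> / 2 * (euclid_norm (x - y))\<^sup>2 \<le> gradient d f x \<bullet> (x - y))"

text \<open>For \<open>u = 0\<close> the junk value \<open>c / 0 = 0\<close> is harmless: the result is the zero vector.\<close>

definition clip :: "real \<Rightarrow> real vec \<Rightarrow> real vec" where
  "clip c u = min 1 (c / euclid_norm u) \<cdot>\<^sub>v u"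

primrec clipped_gd :: "nat \<Rightarrow> (real vec \<Rightarrow> real) \<Rightarrow> real \<Rightarrow> real \<Rightarrow> real vec \<Rightarrow> nat \<Rightarrow> real vec" where
  "clipped_gd d f c \<eta> x0 0 = x0"
| "clipped_gd d f c \<eta> x0 (Suc t) =
     clipped_gd d f c \<eta> x0 t - \<eta> \<cdot>\<^sub>v clip c (gradient d f (clipped_gd d f c \<eta> x0 t))"

end

theory Submission imports Defs
begin

text \<open>
  Since the gradient vanishes at the minimiser \<open>xs\<close>, the two smoothness conditions and convexity make
  the gradient cocoercive towards \<open>xs\<close>: with \<open>g = \<nabla>f x\<close>, the product \<open>g \<bullet> (x - xs)\<close> is at least
  \<open>\<parallel>g\<parallel>\<^sup>2 / L\<close> and \<open>\<parallel>g\<parallel>\<^sup>2 / (L0 + L1 max(c, \<parallel>g\<parallel>))\<close>; strong convexity bounds it below by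
  \<open>\<mu> \<parallel>x - xs\<parallel>\<^sup>2\<close>. Half of the descent \<open>2 \<eta> g \<bullet> (x - xs)\<close> absorbs the quadratic term of a step, and
  the other half is progress. An unclipped step therefore contracts \<open>R\<^sup>2\<close> by the factor \<open>1 - \<mu> \<eta>\<close>. A
  clipped step decreases \<open>R\<^sup>2\<close> by \<open>\<eta> c g \<bullet> (x - xs) / \<parallel>g\<parallel>\<close>, which is at least both \<open>\<eta> c\<^sup>2 / L\<close> and
  \<open>\<eta> c R sqrt (\<mu> / L)\<close>; this bounds the number of clipped steps. All steps decrease \<open>R\<close>, so
  the two kinds can be counted separately.
\<close>

section \<open>Euclidean geometry of real vectors\<close>

lemma scalar_prod_self_nonneg [simp]: "(v :: real vec) \<bullet> v \<ge> 0"
  by (auto simp: scalar_prod_def intro: sum_nonneg)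

lemma euclid_norm_nonneg [simp]: "euclid_norm v \<ge> 0"
  by (simp add: euclid_norm_def)

lemma euclid_norm_sq: "(euclid_norm v)\<^sup>2 = v \<bullet> v"
  by (simp add: euclid_norm_def)

lemma euclid_norm_eq_0_iff:
  assumes "v \<in> carrier_vec d"
  shows "euclid_norm v = 0 \<longleftrightarrow> v = 0\<^sub>v d"
proof
  assume "euclid_norm v = 0"
  then have "(\<Sum>i\<in>{0..<d}. v $ i * v $ i) = 0"
    using assms by (simp add: euclid_norm_def scalar_prod_def)
  then have "\<forall>i\<in>{0..<d}. v $ i * v $ i = 0"
    by (subst (asm) sum_nonneg_eq_0_iff) auto
  then show "v = 0\<^sub>v d" using assms by (intro eq_vecI) auto
qed (simp add: euclid_norm_def scalar_prod_def)

lemma euclid_norm_smult: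
  assumes "v \<in> carrier_vec d"
  shows "euclid_norm (a \<cdot>\<^sub>v v) = \<bar>a\<bar> * euclid_norm v"
proof -
  have "(a \<cdot>\<^sub>v v) \<bullet> (a \<cdot>\<^sub>v v) = a\<^sup>2 * (v \<bullet> v)"
    using assms by (simp add: power2_eq_square)
  then show ?thesis by (simp add: euclid_norm_def real_sqrt_mult)
qed

lemma euclid_norm_sq_diff_smult:
  assumes u: "u \<in> carrier_vec d" and v: "v \<in> carrier_vec d"
  shows "(euclid_norm (u - a \<cdot>\<^sub>v v))\<^sup>2
    = (euclid_norm u)\<^sup>2 - 2 * a * (v \<bullet> u) + a\<^sup>2 * (euclid_norm v)\<^sup>2"
proof -
  have "(u - a \<cdot>\<^sub>v v) \<bullet> (u - a \<cdot>\<^sub>v v) = u \<bullet> (u - a \<cdot>\<^sub>v v) - a * (v \<bullet> (u - a \<cdot>\<^sub>v v))"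
    using u v by (subst minus_scalar_prod_distrib[of _ d]) auto
  also have "\<dots> = u \<bullet> u - a * (u \<bullet> v) - a * (v \<bullet> u) + a * a * (v \<bullet> v)"
    using u v by (simp add: scalar_prod_minus_distrib[of _ d] algebra_simps)
  finally show ?thesis
    unfolding euclid_norm_sq using comm_scalar_prod[OF u v] by (simp add: power2_eq_square)
qed

text \<open>When both norms are nonzero, the square of \<open>u - a v\<close> is expanded with
  \<open>a\<close> the ratio of the norms: \<open>a v\<close> then has the length of
  \<open>u\<close>, and the expansion becomes a positive multiple of the claimed difference.\<close>

lemma scalar_prod_Cauchy_Schwarz:
  assumes u: "(u :: real vec) \<in> carrier_vec d" and v: "v \<in> carrier_vec d"
  shows "u \<bullet> v \<le> euclid_norm u * euclid_norm v"
proof (cases "euclid_norm u = 0 \<or> euclid_norm v = 0")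
  case True
  then show ?thesis using u v by (auto simp: euclid_norm_eq_0_iff)
next
  case False
  then have pos: "euclid_norm u > 0" "euclid_norm v > 0"
    using euclid_norm_nonneg by (metis less_eq_real_def)+
  have "0 \<le> (euclid_norm (u - (euclid_norm u / euclid_norm v) \<cdot>\<^sub>v v))\<^sup>2" by simp
  also have "\<dots> = 2 * (euclid_norm u)\<^sup>2 - 2 * (euclid_norm u / euclid_norm v) * (v \<bullet> u)"
    using pos by (subst euclid_norm_sq_diff_smult[OF u v]) (simp add: power_divide)
  also have "\<dots> = 2 * (euclid_norm u / euclid_norm v) * (euclid_norm u * euclid_norm v - u \<bullet> v)"
    using pos comm_scalar_prod[OF u v] by (simp add: field_simps power2_eq_square)
  finally show ?thesis
    using pos by (smt (verit) divide_pos_pos mult_pos_neg mult_pos_pos)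
qed

section \<open>Gradients along lines\<close>

text \<open>Bridge to one-variable calculus: everything needed about \<open>f\<close> is obtained by
  restricting it to lines and applying results on real derivatives.\<close>

lemma has_gradient_imp_DERIV:
  assumes g: "has_gradient d f g (x + t \<cdot>\<^sub>v v)"
    and x: "x \<in> carrier_vec d" and v: "v \<in> carrier_vec d"
  shows "((\<lambda>s. f (x + s \<cdot>\<^sub>v v)) has_real_derivative g \<bullet> v) (at t)"
  unfolding DERIV_def LIM_def
proof (intro allI impI)
  fix r :: real assume "r > 0"
  \<comment> \<open>Adding 1 keeps \<open>n\<close> positive when \<open>v\<close> is zero, so that
    \<open>r / n\<close> and \<open>\<delta> / n\<close> are usable, and makes the final bound
    strict.\<close>
  define n where "n = euclid_norm v + 1"
  have n: "n > 0" "euclid_norm v < n" by (auto simp: n_def add_nonneg_pos)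
  have gc: "g \<in> carrier_vec d" using g by (simp add: has_gradient_def)
  obtain \<delta> where "\<delta> > 0" and \<delta>: "\<And>y. y \<in> carrier_vec d \<Longrightarrow>
      euclid_norm (y - (x + t \<cdot>\<^sub>v v)) < \<delta> \<Longrightarrow>
      \<bar>f y - f (x + t \<cdot>\<^sub>v v) - g \<bullet> (y - (x + t \<cdot>\<^sub>v v))\<bar>
        \<le> r / n * euclid_norm (y - (x + t \<cdot>\<^sub>v v))"
    using g \<open>r > 0\<close> n unfolding has_gradient_def by (metis divide_pos_pos)
  show "\<exists>s>0. \<forall>h. h \<noteq> 0 \<and> dist h 0 < s \<longrightarrow>
      dist ((f (x + (t + h) \<cdot>\<^sub>v v) - f (x + t \<cdot>\<^sub>v v)) / h) (g \<bullet> v) < r"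
  proof (intro exI conjI allI impI)
    show "\<delta> / n > 0" using \<open>\<delta> > 0\<close> n by simp
  next
    fix h :: real assume h: "h \<noteq> 0 \<and> dist h 0 < \<delta> / n"
    let ?q = "f (x + (t + h) \<cdot>\<^sub>v v) - f (x + t \<cdot>\<^sub>v v)"
    have e: "x + (t + h) \<cdot>\<^sub>v v - (x + t \<cdot>\<^sub>v v) = h \<cdot>\<^sub>v v"
      using x v by (intro eq_vecI) (auto simp: algebra_simps)
    have "\<bar>h\<bar> * euclid_norm v \<le> \<bar>h\<bar> * n" using n by (simp add: mult_left_mono)
    also have "\<dots> < \<delta>" using h n by (simp add: field_simps)
    finally have "\<bar>?q - h * (g \<bullet> v)\<bar> \<le> r / n * (\<bar>h\<bar> * euclid_norm v)"
      using \<delta>[of "x + (t + h) \<cdot>\<^sub>v v"] x v gc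
      unfolding e by (simp add: euclid_norm_smult)
    also have "\<dots> < r / n * (\<bar>h\<bar> * n)"
      using \<open>r > 0\<close> n h by (intro mult_strict_left_mono) auto
    also have "\<dots> = r * \<bar>h\<bar>" using n by simp
    finally have "\<bar>?q - h * (g \<bullet> v)\<bar> / \<bar>h\<bar> < r" using h by (simp add: field_simps)
    then show "dist (?q / h) (g \<bullet> v) < r"
      using h by (simp add: dist_real_def abs_divide[symmetric] diff_divide_distrib)
  qed
qed

text \<open>Both candidates give the same derivative along the line in direction
  \<open>g - g'\<close>, so this difference is orthogonal to itself. This justifies the definite
  description in \<open>gradient\<close>.\<close>

lemma has_gradient_unique:
  assumes g: "has_gradient d f g x" and g': "has_gradient d f g' x" and x: "x \<in> carrier_vec d"
  shows "g = g'"
proof -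
  have c: "g \<in> carrier_vec d" "g' \<in> carrier_vec d"
    using g g' by (auto simp: has_gradient_def)
  define v where "v = g - g'"
  have v: "v \<in> carrier_vec d" using c by (simp add: v_def)
  have "x + 0 \<cdot>\<^sub>v v = x" using x v by (intro eq_vecI) auto
  then have "g \<bullet> v = g' \<bullet> v"
    using g g' has_gradient_imp_DERIV[where t = 0, OF _ x v] by (metis DERIV_unique)
  then have "v \<bullet> v = 0"
    using c v by (simp add: v_def minus_scalar_prod_distrib[of _ d])
  then have "v = 0\<^sub>v d" using v by (simp add: euclid_norm_eq_0_iff[symmetric] euclid_norm_def)
  then have "\<forall>i<d. g $ i = g' $ i"
    using c unfolding v_def by (metis carrier_vecD eq_iff_diff_eq_0 index_minus_vec(1) index_zero_vec(1))
  then show ?thesis using c by (intro eq_vecI) auto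
qed

lemma has_gradient_gradient:
  assumes "differentiable_vec d f" "x \<in> carrier_vec d"
  shows "has_gradient d f (gradient d f x) x"
  unfolding gradient_def using assms
  by (auto simp: differentiable_vec_def intro: theI' has_gradient_unique)

lemma gradient_carrier:
  assumes "differentiable_vec d f" "x \<in> carrier_vec d"
  shows "gradient d f x \<in> carrier_vec d"
  using has_gradient_gradient[OF assms] by (simp add: has_gradient_def)

text \<open>Along the line through the minimiser in the direction of its own gradient
  \<open>g\<close>, the derivative is \<open>g \<bullet> g\<close>, which must vanish at a
  minimum.\<close>

lemma gradient_arg_min:
  assumes diff: "differentiable_vec d f"
    and min: "is_arg_min f (\<lambda>x. x \<in> carrier_vec d) x"
  shows "gradient d f x = 0\<^sub>v d"
proof -
  have x: "x \<in> carrier_vec d" using min by (simp add: is_arg_min_def)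
  define g where "g = gradient d f x"
  have g: "g \<in> carrier_vec d" using gradient_carrier[OF diff x] by (simp add: g_def)
  have 0: "x + 0 \<cdot>\<^sub>v g = x" using x g by (intro eq_vecI) auto
  have "((\<lambda>s. f (x + s \<cdot>\<^sub>v g)) has_real_derivative g \<bullet> g) (at 0)"
    using has_gradient_gradient[OF diff x] 0 x g
    by (intro has_gradient_imp_DERIV) (auto simp: g_def)
  then have "g \<bullet> g = 0"
  proof (rule DERIV_local_min[where d = 1])
    show "\<forall>s. \<bar>0 - s\<bar> < 1 \<longrightarrow> f (x + 0 \<cdot>\<^sub>v g) \<le> f (x + s \<cdot>\<^sub>v g)"
      using min x g 0 by (auto simp: is_arg_min_linorder)
  qed simp
  then show ?thesis using g euclid_norm_eq_0_iff by (simp add: g_def euclid_norm_def)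
qed

text \<open>Smoothness is assumed only between \<open>x\<close> and points within the length of
  \<open>v\<close>, so that the lemma serves both global \<open>L\<close>-smoothness and the local
  \<open>(L0, L1)\<close> condition.\<close>

lemma descent_lemma:
  assumes diff: "differentiable_vec d f"
    and x: "x \<in> carrier_vec d" and v: "v \<in> carrier_vec d"
    and smooth: "\<And>y. y \<in> carrier_vec d \<Longrightarrow> euclid_norm (y - x) \<le> euclid_norm v \<Longrightarrow>
      euclid_norm (gradient d f y - gradient d f x) \<le> K * euclid_norm (y - x)"
  shows "f (x + v) \<le> f x + gradient d f x \<bullet> v + K / 2 * (euclid_norm v)\<^sup>2"
proof -
  define g where "g = gradient d f x"
  have g: "g \<in> carrier_vec d" using gradient_carrier[OF diff x] by (simp add: g_def)
  \<comment> \<open>\<open>\<phi>\<close> is \<open>f\<close> on the segment minus the claimed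
    quadratic upper model; Cauchy-Schwarz and smoothness make its derivative nonpositive on
    [0, 1].\<close>
  define \<phi> where "\<phi> = (\<lambda>t. f (x + t \<cdot>\<^sub>v v) - t * (g \<bullet> v) - K / 2 * t\<^sup>2 * (euclid_norm v)\<^sup>2)"
  have "\<phi> 1 \<le> \<phi> 0"
  proof (rule DERIV_nonpos_imp_nonincreasing[where f = \<phi>])
    fix t :: real assume t: "0 \<le> t" "t \<le> 1"
    let ?y = "x + t \<cdot>\<^sub>v v"
    let ?g = "gradient d f ?y"
    have y: "?y \<in> carrier_vec d" using x v by simp
    have gy: "?g \<in> carrier_vec d" by (rule gradient_carrier[OF diff y])
    have "?y - x = t \<cdot>\<^sub>v v" using x v by (intro eq_vecI) auto
    then have n: "euclid_norm (?y - x) = t * euclid_norm v"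
      using v t by (simp add: euclid_norm_smult)
    have "(?g - g) \<bullet> v \<le> euclid_norm (?g - g) * euclid_norm v"
      using gy g v by (intro scalar_prod_Cauchy_Schwarz[of _ d]) auto
    also have "\<dots> \<le> (K * (t * euclid_norm v)) * euclid_norm v"
      using smooth[OF y] t mult_left_le_one_le[of "euclid_norm v" t] unfolding n g_def
      by (intro mult_right_mono) auto
    finally have le: "?g \<bullet> v - g \<bullet> v - K * t * (euclid_norm v)\<^sup>2 \<le> 0"
      using gy g v by (simp add: minus_scalar_prod_distrib[of _ d] power2_eq_square algebra_simps)
    have D: "((\<lambda>t. f (x + t \<cdot>\<^sub>v v)) has_real_derivative ?g \<bullet> v) (at t)"
      by (rule has_gradient_imp_DERIV[OF has_gradient_gradient[OF diff y] x v])
    have "(\<phi> has_real_derivative ?g \<bullet> v - g \<bullet> v - K * t * (euclid_norm v)\<^sup>2) (at t)"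
      unfolding \<phi>_def by (rule derivative_eq_intros D refl)+ simp
    with le show "\<exists>D. (\<phi> has_real_derivative D) (at t) \<and> D \<le> 0" by blast
  qed simp
  moreover have "x + 0 \<cdot>\<^sub>v v = x" using x v by (intro eq_vecI) auto
  ultimately show ?thesis by (simp add: \<phi>_def g_def)
qed

section \<open>Cocoercivity towards the minimiser\<close>

locale clipped_gd_objective =
  fixes d :: nat and f :: "real vec \<Rightarrow> real" and \<mu> L L0 L1 :: real and xs :: "real vec"
  assumes mu_pos: "\<mu> > 0"
    and sc: "strongly_convex d \<mu> f"
    and L_smooth: "L_smooth d L f"
    and L0_L1_smooth: "L0_L1_smooth d L0 L1 f"
    and arg_min: "is_arg_min f (\<lambda>x. x \<in> carrier_vec d) xs"
begin

abbreviation grad where "grad \<equiv> gradient d f"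

lemma diff: "differentiable_vec d f"
  using L_smooth by (simp add: L_smooth_def)

lemma xs_carrier [simp]: "xs \<in> carrier_vec d"
  using arg_min by (simp add: is_arg_min_def)

lemma dim_xs [simp]: "dim_vec xs = d"
  using xs_carrier by (rule carrier_vecD)

lemma xs_min: "x \<in> carrier_vec d \<Longrightarrow> f xs \<le> f x"
  using arg_min by (auto simp: is_arg_min_linorder)

lemma grad_carrier [simp]: "x \<in> carrier_vec d \<Longrightarrow> grad x \<in> carrier_vec d"
  by (rule gradient_carrier[OF diff])

lemma dim_grad [simp]: "x \<in> carrier_vec d \<Longrightarrow> dim_vec (grad x) = d"
  by (rule carrier_vecD[OF grad_carrier])

lemma grad_xs: "grad xs = 0\<^sub>v d"
  by (rule gradient_arg_min[OF diff arg_min])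

text \<open>Strong convexity is applied to the pair in both orders and summed: the function values
  cancel, the two halves of \<open>\<mu>\<close> add up, and the gradient at \<open>xs\<close>
  vanishes.\<close>

lemma scalar_prod_grad_ge_dist:
  assumes x: "x \<in> carrier_vec d"
  shows "grad x \<bullet> (x - xs) \<ge> \<mu> * (euclid_norm (x - xs))\<^sup>2"
proof -
  have "xs - x = (-1) \<cdot>\<^sub>v (x - xs)" using x by (intro eq_vecI) auto
  then have "euclid_norm (xs - x) = euclid_norm (x - xs)"
    using x xs_carrier by (simp add: euclid_norm_smult[of _ d])
  moreover have "f xs - f x + \<mu> / 2 * (euclid_norm (xs - x))\<^sup>2 \<le> grad xs \<bullet> (xs - x)"
    "f x - f xs + \<mu> / 2 * (euclid_norm (x - xs))\<^sup>2 \<le> grad x \<bullet> (x - xs)"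
    using sc x by (auto simp: strongly_convex_def)
  moreover have "grad xs \<bullet> (xs - x) = 0" using x by (simp add: grad_xs)
  ultimately show ?thesis by (simp add: field_simps)
qed

text \<open>
  A gradient step of \<open>f\<close> from \<open>x\<close>, and one of \<open>f - g \<bullet> _\<close> with \<open>g = \<nabla>f x\<close> from \<open>xs\<close>, both of length
  \<open>\<parallel>g\<parallel> / K\<close>, each gain \<open>\<parallel>g\<parallel>\<^sup>2 / (2 K)\<close>; hence smoothness is only needed within that distance of the
  two points.
\<close>

lemma scalar_prod_grad_ge_grad:
  assumes x: "x \<in> carrier_vec d" and K: "K > 0"
    and smooth: "\<And>y z. z \<in> {x, xs} \<Longrightarrow> y \<in> carrier_vec d \<Longrightarrow>
      euclid_norm (y - z) \<le> euclid_norm (grad x) / K \<Longrightarrow>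
      euclid_norm (grad y - grad z) \<le> K * euclid_norm (y - z)"
  shows "grad x \<bullet> (x - xs) \<ge> (euclid_norm (grad x))\<^sup>2 / K"
proof -
  define g where "g = grad x"
  have g: "g \<in> carrier_vec d" using x by (simp add: g_def)
  define v where "v = (1 / K) \<cdot>\<^sub>v g"
  define w where "w = (- 1 / K) \<cdot>\<^sub>v g"
  have v: "v \<in> carrier_vec d" and w: "w \<in> carrier_vec d" using g by (auto simp: v_def w_def)
  have nv: "euclid_norm v = euclid_norm g / K" and nw: "euclid_norm w = euclid_norm g / K"
    using g K by (simp_all add: v_def w_def euclid_norm_smult)
  have gv: "g \<bullet> v = (euclid_norm g)\<^sup>2 / K" and gw: "g \<bullet> w = - ((euclid_norm g)\<^sup>2 / K)"
    using g by (simp_all add: v_def w_def euclid_norm_sq)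
  have sq: "K / 2 * (euclid_norm g / K)\<^sup>2 = (euclid_norm g)\<^sup>2 / (2 * K)"
    using K by (simp add: field_simps power2_eq_square)
  have half: "(euclid_norm g)\<^sup>2 / K = 2 * ((euclid_norm g)\<^sup>2 / (2 * K))" by simp
  have "f xs \<le> f (x + w)" using x w by (simp add: xs_min)
  also have "f (x + w) \<le> f x + g \<bullet> w + K / 2 * (euclid_norm w)\<^sup>2"
    unfolding g_def by (rule descent_lemma[OF diff x w]) (auto intro: smooth simp: nw g_def)
  finally have 1: "f xs \<le> f x - (euclid_norm g)\<^sup>2 / (2 * K)"
    unfolding nw gw sq half by simp
  have "f (xs + v) \<le> f xs + grad xs \<bullet> v + K / 2 * (euclid_norm v)\<^sup>2"
    by (rule descent_lemma[OF diff xs_carrier v]) (auto intro: smooth simp: nv g_def)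
  then have 2: "f (xs + v) \<le> f xs + (euclid_norm g)\<^sup>2 / (2 * K)"
    unfolding nv sq using v by (simp add: grad_xs)
  have "x - (xs + v) = (x - xs) - v" using x v by (intro eq_vecI) auto
  then have 3: "g \<bullet> (x - (xs + v)) = g \<bullet> (x - xs) - (euclid_norm g)\<^sup>2 / K"
    using g x v xs_carrier by (simp add: scalar_prod_minus_distrib[of _ d] gv)
  have "f x - f (xs + v) + \<mu> / 2 * (euclid_norm (x - (xs + v)))\<^sup>2 \<le> g \<bullet> (x - (xs + v))"
    using sc x v by (simp add: strongly_convex_def g_def)
  moreover have "\<mu> / 2 * (euclid_norm (x - (xs + v)))\<^sup>2 \<ge> 0" using mu_pos by simp
  ultimately have "f x - f (xs + v) \<le> g \<bullet> (x - xs) - (euclid_norm g)\<^sup>2 / K"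
    using 3 by linarith
  \<comment> \<open>The two gains \<open>1\<close> and \<open>2\<close> together say
    \<open>f (xs + v) \<le> f x\<close>, so the left side of the preceding inequality is
    nonnegative.\<close>
  with 1 2 have "g \<bullet> (x - xs) \<ge> (euclid_norm g)\<^sup>2 / K"
    using half by linarith
  then show ?thesis by (simp add: g_def)
qed

lemma grad_le_dist:
  assumes x: "x \<in> carrier_vec d"
  shows "euclid_norm (grad x) \<le> L * euclid_norm (x - xs)"
proof -
  have "grad x - grad xs = grad x" using x by (simp add: grad_xs)
  moreover have "euclid_norm (grad x - grad xs) \<le> L * euclid_norm (x - xs)"
    using L_smooth x xs_carrier unfolding L_smooth_def by blast
  ultimately show ?thesis by simp
qed

text \<open>Positivity of \<open>L\<close> is not a hypothesis of the theorem. Away from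
  \<open>xs\<close>, strong convexity and smoothness bound the same scalar product from both sides,
  which gives \<open>\<mu> \<le> L\<close>.\<close>

lemma L_pos:
  assumes x: "x \<in> carrier_vec d" and ne: "x \<noteq> xs"
  shows "L > 0"
proof -
  have pos: "euclid_norm (x - xs) > 0"
  proof -
    have "x - xs \<noteq> 0\<^sub>v d"
    proof
      assume "x - xs = 0\<^sub>v d"
      then have "\<forall>i<d. x $ i = xs $ i"
        using x xs_carrier
        by (metis carrier_vecD eq_iff_diff_eq_0 index_minus_vec(1) index_zero_vec(1))
      then have "x = xs" using x by (intro eq_vecI) auto
      with ne show False by simp
    qed
    then have "euclid_norm (x - xs) \<noteq> 0" using x by (simp add: euclid_norm_eq_0_iff[of _ d])
    then show ?thesis using euclid_norm_nonneg by (metis less_eq_real_def)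
  qed
  have "\<mu> * (euclid_norm (x - xs))\<^sup>2 \<le> grad x \<bullet> (x - xs)" by (rule scalar_prod_grad_ge_dist[OF x])
  also have "\<dots> \<le> euclid_norm (grad x) * euclid_norm (x - xs)"
    using x by (intro scalar_prod_Cauchy_Schwarz[of _ d]) auto
  also have "\<dots> \<le> L * (euclid_norm (x - xs))\<^sup>2"
    using mult_right_mono[OF grad_le_dist[OF x] euclid_norm_nonneg]
    by (simp add: power2_eq_square mult.assoc)
  finally have "\<mu> \<le> L" using pos by simp
  with mu_pos show ?thesis by simp
qed

lemma scalar_prod_grad_ge_L:
  assumes x: "x \<in> carrier_vec d" and L: "L > 0"
  shows "grad x \<bullet> (x - xs) \<ge> (euclid_norm (grad x))\<^sup>2 / L"
  using L_smooth xs_carrier x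
  by (intro scalar_prod_grad_ge_grad[OF x L]) (auto simp: L_smooth_def)

text \<open>The choice of \<open>K\<close> keeps the radius \<open>euclid_norm (grad x) / K\<close>
  within \<open>1 / L1\<close>. The local condition is used with \<open>x\<close> or
  \<open>xs\<close> as its first argument, where the gradient norm is at most that at
  \<open>x\<close>, so its constant is at most \<open>K\<close>. Leaving \<open>K\<close> free lets
  unclipped steps take \<open>L0 + c * L1\<close> and clipped ones
  \<open>L0 + L1 * euclid_norm (grad x)\<close>.\<close>

lemma scalar_prod_grad_ge_L0_L1:
  assumes x: "x \<in> carrier_vec d" and K: "K > 0" "K \<ge> L0 + L1 * euclid_norm (grad x)"
  shows "grad x \<bullet> (x - xs) \<ge> (euclid_norm (grad x))\<^sup>2 / K"
proof (rule scalar_prod_grad_ge_grad[OF x K(1)])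
  have L01: "L0 \<ge> 0" "L1 \<ge> 0" using L0_L1_smooth by (auto simp: L0_L1_smooth_def)
  fix y z assume z: "z \<in> {x, xs}" and y: "y \<in> carrier_vec d"
    and le: "euclid_norm (y - z) \<le> euclid_norm (grad x) / K"
  have zc: "z \<in> carrier_vec d" using z x by auto
  have sym: "euclid_norm (a - b) = euclid_norm (b - a)"
    if "a \<in> carrier_vec d" "b \<in> carrier_vec d" for a b
  proof -
    have "a - b = (-1) \<cdot>\<^sub>v (b - a)" using that by (intro eq_vecI) auto
    then show ?thesis using that by (simp add: euclid_norm_smult[of _ d])
  qed
  have "L1 = 0 \<or> euclid_norm (z - y) \<le> 1 / L1"
  proof (rule disjCI)
    assume "\<not> euclid_norm (z - y) \<le> 1 / L1"
    with le have "1 / L1 < euclid_norm (grad x) / K" using sym[OF y zc] by simp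
    then have "L1 > 0 \<Longrightarrow> K < L1 * euclid_norm (grad x)"
      using K by (simp add: field_simps)
    then show "L1 = 0" using K L01 by linarith
  qed
  then have "euclid_norm (grad z - grad y)
      \<le> (L0 + L1 * euclid_norm (grad z)) * euclid_norm (z - y)"
    using L0_L1_smooth y zc unfolding L0_L1_smooth_def by blast
  also have "L0 + L1 * euclid_norm (grad z) \<le> K"
  proof -
    have "euclid_norm (grad xs) = 0" by (simp add: grad_xs euclid_norm_eq_0_iff[of _ d])
    then have "euclid_norm (grad z) \<le> euclid_norm (grad x)" using z by auto
    from mult_left_mono[OF this L01(2)] show ?thesis using K by simp
  qed
  finally show "euclid_norm (grad y - grad z) \<le> K * euclid_norm (y - z)"
    using sym[OF y zc] sym[of "grad y" "grad z"] y zc by (simp add: mult_right_mono)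
qed

section \<open>One step of clipped gradient descent\<close>

text \<open>Clipping merely rescales the step size, so the expansion of the square for an ordinary
  gradient step applies.\<close>

lemma clipped_step_eq:
  assumes x: "x \<in> carrier_vec d"
  shows "(euclid_norm (x - \<eta> \<cdot>\<^sub>v clip c (grad x) - xs))\<^sup>2
    = (euclid_norm (x - xs))\<^sup>2
      - 2 * (\<eta> * min 1 (c / euclid_norm (grad x))) * (grad x \<bullet> (x - xs))
      + (\<eta> * min 1 (c / euclid_norm (grad x)))\<^sup>2 * (euclid_norm (grad x))\<^sup>2"
proof -
  let ?a = "\<eta> * min 1 (c / euclid_norm (grad x))"
  have "x - \<eta> \<cdot>\<^sub>v clip c (grad x) - xs = (x - xs) - ?a \<cdot>\<^sub>v grad x"
    using x by (intro eq_vecI) (auto simp: clip_def)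
  then show ?thesis using x euclid_norm_sq_diff_smult[of "x - xs" d "grad x" ?a] by simp
qed

lemma unclipped_step:
  assumes x: "x \<in> carrier_vec d" and c: "c > 0"
    and eta: "\<eta> > 0" "\<eta> \<le> inverse (L0 + c * L1)"
    and small: "euclid_norm (grad x) \<le> c"
  shows "(euclid_norm (x - \<eta> \<cdot>\<^sub>v clip c (grad x) - xs))\<^sup>2
    \<le> (1 - \<mu> * \<eta>) * (euclid_norm (x - xs))\<^sup>2"
proof -
  define K where "K = L0 + c * L1"
  \<comment> \<open>Since \<open>inverse 0 = 0\<close>, a positive \<open>\<eta>\<close> below the
    inverse already forces \<open>K\<close> to be nonzero.\<close>
  have "inverse K > 0" unfolding K_def using eta by linarith
  then have K: "K > 0" by simp
  have L1: "L1 \<ge> 0" using L0_L1_smooth by (simp add: L0_L1_smooth_def)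
  let ?n = "euclid_norm (grad x)"
  have "L1 * ?n \<le> L1 * c" using small L1 by (rule mult_left_mono)
  then have "K \<ge> L0 + L1 * ?n" by (simp add: K_def mult.commute)
  then have coc: "grad x \<bullet> (x - xs) \<ge> ?n\<^sup>2 / K"
    by (rule scalar_prod_grad_ge_L0_L1[OF x K])
  have "\<eta> * ?n\<^sup>2 \<le> inverse K * ?n\<^sup>2"
    using eta by (intro mult_right_mono) (auto simp: K_def)
  also have "\<dots> \<le> grad x \<bullet> (x - xs)" using coc by (simp add: field_simps)
  finally have "\<eta> * (\<eta> * ?n\<^sup>2) \<le> \<eta> * (grad x \<bullet> (x - xs))"
    using eta by (intro mult_left_mono) auto
  moreover have "\<eta> * (\<mu> * (euclid_norm (x - xs))\<^sup>2) \<le> \<eta> * (grad x \<bullet> (x - xs))"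
    using eta scalar_prod_grad_ge_dist[OF x] by (intro mult_left_mono) auto
  moreover have "(euclid_norm (x - \<eta> \<cdot>\<^sub>v clip c (grad x) - xs))\<^sup>2
    = (euclid_norm (x - xs))\<^sup>2 - 2 * (\<eta> * (grad x \<bullet> (x - xs))) + \<eta> * (\<eta> * ?n\<^sup>2)"
  proof (cases "?n = 0")
    \<comment> \<open>For a zero gradient \<open>c / 0 = 0\<close> makes the scaling factor 0 rather
      than 1, but then the linear and quadratic terms vanish anyway.\<close>
    case True
    then have "grad x \<bullet> (x - xs) = 0" using x by (simp add: euclid_norm_eq_0_iff[of _ d])
    then show ?thesis using True by (simp add: clipped_step_eq[OF x])
  next
    case False
    then have "?n > 0" using euclid_norm_nonneg by (simp add: less_le)
    then have "min 1 (c / ?n) = 1" using small by (simp add: min_def le_divide_eq)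
    then show ?thesis unfolding clipped_step_eq[OF x] by (simp add: power2_eq_square)
  qed
  ultimately show ?thesis by (simp add: algebra_simps)
qed

text \<open>The effective step size \<open>\<eta> * c / n\<close> must be at most
  \<open>1 / K\<close> for the larger constant \<open>K = L0 + L1 * n\<close>. This follows because
  \<open>K / n\<close> does not increase with \<open>n\<close>, and \<open>n > c\<close>.\<close>

lemma clipped_step:
  assumes x: "x \<in> carrier_vec d" and c: "c > 0"
    and eta: "\<eta> > 0" "\<eta> \<le> inverse (L0 + c * L1)"
    and large: "euclid_norm (grad x) > c"
  shows "(euclid_norm (x - \<eta> \<cdot>\<^sub>v clip c (grad x) - xs))\<^sup>2
    \<le> (euclid_norm (x - xs))\<^sup>2 - \<eta> * c / euclid_norm (grad x) * (grad x \<bullet> (x - xs))"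
proof -
  have "inverse (L0 + c * L1) > 0" using eta by linarith
  then have K0: "L0 + c * L1 > 0" by simp
  have L01: "L0 \<ge> 0" "L1 \<ge> 0" using L0_L1_smooth by (auto simp: L0_L1_smooth_def)
  define n where "n = euclid_norm (grad x)"
  define K where "K = L0 + L1 * n"
  have n: "n > c" "n > 0" using large c by (auto simp: n_def)
  have "c * L1 \<le> L1 * n" using L01 n by (simp add: mult.commute mult_left_mono)
  then have K: "K > 0" using K0 by (simp add: K_def)
  have coc: "grad x \<bullet> (x - xs) \<ge> n\<^sup>2 / K"
    using scalar_prod_grad_ge_L0_L1[OF x K] by (simp add: K_def n_def)
  have "L0 * c \<le> L0 * n" using L01 n by (intro mult_left_mono) auto
  then have "c * K \<le> n * (L0 + c * L1)" by (simp add: K_def algebra_simps)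
  then have "c * inverse (L0 + c * L1) \<le> n / K"
    using K K0 by (simp add: field_simps)
  moreover have "c * \<eta> \<le> c * inverse (L0 + c * L1)"
    using c eta by (intro mult_left_mono) auto
  ultimately have "n * (c * \<eta>) \<le> n * (n / K)" using n by (intro mult_left_mono) auto
  also have "\<dots> \<le> grad x \<bullet> (x - xs)" using coc by (simp add: power2_eq_square)
  finally have "\<eta> * c / n * (n * (c * \<eta>)) \<le> \<eta> * c / n * (grad x \<bullet> (x - xs))"
    using n c eta by (intro mult_left_mono) auto
  moreover have "\<eta> * c / n * (n * (c * \<eta>)) = (\<eta> * (c / n))\<^sup>2 * n\<^sup>2"
    using n by (simp add: field_simps power2_eq_square)
  moreover have "min 1 (c / n) = c / n" using n by (simp add: min_def)
  ultimately show ?thesis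
    by (simp add: clipped_step_eq[OF x] n_def[symmetric])
qed

text \<open>Two lower bounds on \<open>p\<close> give two rates. The bound
  \<open>n\<^sup>2 / L\<close> with \<open>n > c\<close> yields a fixed decrease of the squared
  distance; the geometric mean of both bounds is proportional to \<open>n * R\<close>, so
  \<open>n\<close> cancels and the distance itself drops by a fixed amount.\<close>

lemma clipped_step_progress:
  assumes x: "x \<in> carrier_vec d" and c: "c > 0" and L: "L > 0"
    and eta: "\<eta> > 0" "\<eta> \<le> inverse (L0 + c * L1)"
    and large: "euclid_norm (grad x) > c"
  defines "x' \<equiv> x - \<eta> \<cdot>\<^sub>v clip c (grad x)"
  shows "euclid_norm (x' - xs) \<le> euclid_norm (x - xs) - \<eta> * c * sqrt (\<mu> / L) / 2"
    and "(euclid_norm (x' - xs))\<^sup>2 \<le> (euclid_norm (x - xs))\<^sup>2 - \<eta> * c\<^sup>2 / L"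
proof -
  define n where "n = euclid_norm (grad x)"
  define R where "R = euclid_norm (x - xs)"
  define R' where "R' = euclid_norm (x' - xs)"
  define p where "p = grad x \<bullet> (x - xs)"
  have n: "n > c" "n > 0" using large c by (auto simp: n_def)
  have p: "p \<ge> n\<^sup>2 / L" "p \<ge> \<mu> * R\<^sup>2"
    using scalar_prod_grad_ge_L[OF x L] scalar_prod_grad_ge_dist[OF x]
    by (auto simp: p_def n_def R_def)
  have "p \<ge> 0" using p(2) mu_pos by (smt (verit) mult_nonneg_nonneg zero_le_power2)
  have step: "R'\<^sup>2 \<le> R\<^sup>2 - \<eta> * c / n * p"
    using clipped_step[OF x c eta large] by (simp add: R'_def R_def n_def p_def x'_def)
  have "L * R > 0" using grad_le_dist[OF x] n by (simp add: n_def R_def)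
  then have R: "R > 0" using L by (simp add: zero_less_mult_iff)
  have "\<eta> * c / n * (n\<^sup>2 / L) \<le> \<eta> * c / n * p"
    using p c n eta by (intro mult_left_mono) auto
  moreover have "\<eta> * c * c / L \<le> \<eta> * c * n / L"
    using n c eta L by (intro divide_right_mono mult_left_mono) auto
  moreover have "\<eta> * c / n * (n\<^sup>2 / L) = \<eta> * c * n / L"
    using n by (simp add: power2_eq_square)
  moreover have "\<eta> * c * c / L = \<eta> * c\<^sup>2 / L" by (simp add: power2_eq_square)
  ultimately show "(euclid_norm (x' - xs))\<^sup>2 \<le> (euclid_norm (x - xs))\<^sup>2 - \<eta> * c\<^sup>2 / L"
    using step unfolding R'_def R_def by linarith
  define s where "s = \<eta> * c * sqrt (\<mu> / L)"
  have s: "s \<ge> 0" using eta c mu_pos L by (simp add: s_def)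
  have "(n * R * sqrt (\<mu> / L))\<^sup>2 = (n\<^sup>2 / L) * (\<mu> * R\<^sup>2)"
    using mu_pos L by (simp add: power_mult_distrib)
  also have "\<dots> \<le> p * p"
    using p \<open>p \<ge> 0\<close> mu_pos L by (intro mult_mono) auto
  finally have "n * R * sqrt (\<mu> / L) \<le> p"
    using \<open>p \<ge> 0\<close> by (metis power2_eq_square power2_le_imp_le)
  then have "\<eta> * c / n * (n * R * sqrt (\<mu> / L)) \<le> \<eta> * c / n * p"
    using n c eta by (intro mult_left_mono) auto
  then have "s * R \<le> \<eta> * c / n * p" using n by (simp add: s_def mult_ac)
  with step have le: "R'\<^sup>2 \<le> R\<^sup>2 - s * R" by simp
  \<comment> \<open>Nonnegativity of \<open>R'\<^sup>2\<close> gives \<open>s \<le> R\<close>, which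
    makes \<open>R - s / 2\<close> nonnegative; completing the square then permits taking
    roots.\<close>
  then have "s * R \<le> R * R" using zero_le_power2[of R'] unfolding power2_eq_square by linarith
  then have "s \<le> R" using R by simp
  have "(R - s / 2)\<^sup>2 = R\<^sup>2 - s * R + (s / 2)\<^sup>2" by (simp add: power2_eq_square field_simps)
  then have "R'\<^sup>2 \<le> (R - s / 2)\<^sup>2" using le zero_le_power2[of "s / 2"] by linarith
  moreover have "R - s / 2 \<ge> 0" using \<open>s \<le> R\<close> R by simp
  ultimately have "R' \<le> R - s / 2" by (rule power2_le_imp_le)
  then show "euclid_norm (x' - xs) \<le> euclid_norm (x - xs) - \<eta> * c * sqrt (\<mu> / L) / 2"
    by (simp add: R'_def R_def s_def)
qed

lemma clipped_gd_carrier: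
  "x0 \<in> carrier_vec d \<Longrightarrow> clipped_gd d f c \<eta> x0 t \<in> carrier_vec d"
  by (induction t) (auto simp: clip_def)

end

section \<open>Counting the steps\<close>

text \<open>Here \<open>k\<close> counts the subtractive steps and \<open>u\<close> the contracting
  ones. Each of the three bounds is driven by one kind of step and survives the other because no
  step increases \<open>R\<close>; hence the order of the steps is irrelevant.\<close>

lemma count_two_kinds_of_steps:
  fixes R :: "nat \<Rightarrow> real"
  assumes R: "\<And>t. R t \<ge> 0" and a: "a \<ge> 0" and p: "p \<ge> 0" and q: "q \<ge> 0"
    and step: "\<And>t. (R (Suc t))\<^sup>2 \<le> (1 - a) * (R t)\<^sup>2 \<or>
      (R (Suc t) \<le> R t - p \<and> (R (Suc t))\<^sup>2 \<le> (R t)\<^sup>2 - q)"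
  shows "\<exists>k u. k + u = T \<and> R T \<le> R 0 - real k * p \<and> (R T)\<^sup>2 \<le> (R 0)\<^sup>2 - real k * q \<and>
    (R T)\<^sup>2 \<le> exp (- a * real u) * (R 0)\<^sup>2"
proof (induction T)
  case 0
  then show ?case by (intro exI[of _ 0]) simp
next
  case (Suc T)
  then obtain k u where ku: "k + u = T" "R T \<le> R 0 - real k * p"
    "(R T)\<^sup>2 \<le> (R 0)\<^sup>2 - real k * q" "(R T)\<^sup>2 \<le> exp (- a * real u) * (R 0)\<^sup>2" by blast
  from step[of T] show ?case
  proof
    assume s: "(R (Suc T))\<^sup>2 \<le> (1 - a) * (R T)\<^sup>2"
    also have "\<dots> \<le> (R T)\<^sup>2" using a by (simp add: mult_left_le_one_le algebra_simps)
    finally have le: "(R (Suc T))\<^sup>2 \<le> (R T)\<^sup>2" .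
    then have "R (Suc T) \<le> R T" using R by (rule power2_le_imp_le)
    moreover have "(R (Suc T))\<^sup>2 \<le> exp (- a * real (Suc u)) * (R 0)\<^sup>2"
    proof -
      have "(1 - a) * (R T)\<^sup>2 \<le> exp (- a) * (R T)\<^sup>2"
        using exp_ge_add_one_self[of "- a"] by (intro mult_right_mono) auto
      also have "\<dots> \<le> exp (- a) * (exp (- a * real u) * (R 0)\<^sup>2)"
        using ku by (intro mult_left_mono) auto
      also have "\<dots> = exp (- a * real (Suc u)) * (R 0)\<^sup>2"
        by (simp add: exp_add[symmetric] algebra_simps)
      finally show ?thesis using s by linarith
    qed
    ultimately show ?thesis using ku le by (intro exI[of _ k] exI[of _ "Suc u"]) auto
  next
    assume "R (Suc T) \<le> R T - p \<and> (R (Suc T))\<^sup>2 \<le> (R T)\<^sup>2 - q"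
    then show ?thesis using ku q
      by (intro exI[of _ "Suc k"] exI[of _ u]) (auto simp: algebra_simps)
  qed
qed

section \<open>From step counts to the iteration bound\<close>

theorem theorem2p5:
  shows "\<exists>C::real. C > 0 \<and>
    (\<forall>(d::nat) (f :: real vec \<Rightarrow> real) (\<mu>::real) (L::real) (L0::real) (L1::real)
       (xs :: real vec) (c::real) (\<eta>::real) (x0 :: real vec).
      \<mu> > 0 \<longrightarrow> strongly_convex d \<mu> f \<longrightarrow> L_smooth d L f \<longrightarrow> L0_L1_smooth d L0 L1 f \<longrightarrow>
      is_arg_min f (\<lambda>x. x \<in> carrier_vec d) xs \<longrightarrow>
      c > 0 \<longrightarrow> \<eta> > 0 \<longrightarrow> \<eta> \<le> inverse (L0 + c * L1) \<longrightarrow>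
      x0 \<in> carrier_vec d \<longrightarrow> x0 \<noteq> xs \<longrightarrow>
      (let R = (\<lambda>t. euclid_norm (clipped_gd d f c \<eta> x0 t - xs)) in
        \<forall>\<epsilon>>0. \<forall>T::nat.
          real T \<ge> C * (1 / (\<mu> * \<eta>) * ln ((R 0)\<^sup>2 / \<epsilon>)
                        + R 0 / (c * \<eta>) * min (sqrt (L / \<mu>)) (L * R 0 / c))
          \<longrightarrow> (R T)\<^sup>2 \<le> \<epsilon>))"
proof (intro exI[of _ 2] conjI allI impI)
  \<comment> \<open>The constant 2 comes from the factor 1/2 in \<open>p\<close>: at most
    \<open>2 * B\<close> steps are clipped, which leaves at least \<open>2 * A\<close> unclipped
    ones, and \<open>A\<close> of these suffice.\<close>
  fix d f and \<mu> L L0 L1 :: real and xs and c \<eta> :: real and x0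
  assume mu: "\<mu> > 0" and "strongly_convex d \<mu> f" "L_smooth d L f" "L0_L1_smooth d L0 L1 f"
    "is_arg_min f (\<lambda>x. x \<in> carrier_vec d) xs"
    and c: "c > 0" and eta: "\<eta> > 0" "\<eta> \<le> inverse (L0 + c * L1)"
    and x0: "x0 \<in> carrier_vec d" "x0 \<noteq> xs"
  then interpret clipped_gd_objective d f \<mu> L L0 L1 xs by unfold_locales
  have L: "L > 0" by (rule L_pos[OF x0])
  define R where "R = (\<lambda>t. euclid_norm (clipped_gd d f c \<eta> x0 t - xs))"
  define p where "p = \<eta> * c * sqrt (\<mu> / L) / 2"
  define q where "q = \<eta> * c\<^sup>2 / L"
  have pq: "p > 0" "q > 0" using mu c eta L by (auto simp: p_def q_def)
  have R_nonneg: "R t \<ge> 0" for t by (simp add: R_def)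
  have step: "(R (Suc t))\<^sup>2 \<le> (1 - \<mu> * \<eta>) * (R t)\<^sup>2 \<or>
      (R (Suc t) \<le> R t - p \<and> (R (Suc t))\<^sup>2 \<le> (R t)\<^sup>2 - q)" for t
  proof -
    have x: "clipped_gd d f c \<eta> x0 t \<in> carrier_vec d" by (rule clipped_gd_carrier[OF x0(1)])
    show ?thesis
      using unclipped_step[OF x c eta] clipped_step_progress[OF x c L eta]
      by (cases "euclid_norm (grad (clipped_gd d f c \<eta> x0 t)) \<le> c")
        (auto simp: R_def p_def q_def)
  qed
  have "(R T)\<^sup>2 \<le> \<epsilon>"
    if eps: "\<epsilon> > 0" and T: "real T \<ge> 2 * (1 / (\<mu> * \<eta>) * ln ((R 0)\<^sup>2 / \<epsilon>)
      + R 0 / (c * \<eta>) * min (sqrt (L / \<mu>)) (L * R 0 / c))" for \<epsilon> T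
  proof -
    define A where "A = 1 / (\<mu> * \<eta>) * ln ((R 0)\<^sup>2 / \<epsilon>)"
    define B where "B = R 0 / (c * \<eta>) * min (sqrt (L / \<mu>)) (L * R 0 / c)"
    obtain k u where ku: "k + u = T" "R T \<le> R 0 - real k * p"
      "(R T)\<^sup>2 \<le> (R 0)\<^sup>2 - real k * q" "(R T)\<^sup>2 \<le> exp (- (\<mu> * \<eta>) * real u) * (R 0)\<^sup>2"
      using count_two_kinds_of_steps[of R "\<mu> * \<eta>" p q T] R_nonneg step mu eta pq by auto
    show ?thesis
    proof (cases "(R 0)\<^sup>2 \<le> \<epsilon>")
      \<comment> \<open>Here the logarithm is at most 0 and the lower bound on \<open>T\<close> may
        be void, so monotonicity of the distance is used instead.\<close>
      case True
      have "real k * q \<ge> 0" using pq by simp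
      then show ?thesis using ku True by linarith
    next
      case False
      then have ratio: "(R 0)\<^sup>2 / \<epsilon> > 1" using eps by simp
      have "real k * p \<le> R 0" using ku R_nonneg[of T] by linarith
      then have "real k \<le> R 0 / p" using pq by (simp add: field_simps)
      also have "R 0 / p = 2 * (R 0 / (c * \<eta>) * sqrt (L / \<mu>))"
        using mu L c eta by (simp add: p_def real_sqrt_divide field_simps)
      finally have k1: "real k \<le> 2 * (R 0 / (c * \<eta>) * sqrt (L / \<mu>))" .
      have "real k * q \<le> (R 0)\<^sup>2" using ku(3) zero_le_power2[of "R T"] by linarith
      then have "real k \<le> (R 0)\<^sup>2 / q" using pq by (simp add: field_simps)
      also have "\<dots> = R 0 / (c * \<eta>) * (L * R 0 / c)"
        using L c eta by (simp add: q_def field_simps power2_eq_square)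
      \<comment> \<open>This bound holds with factor 1; it is doubled to match \<open>k1\<close>, so
        that both combine into the minimum in \<open>B\<close>.\<close>
      also have "\<dots> \<le> 2 * \<dots>"
      proof -
        have "0 \<le> R 0 / (c * \<eta>) * (L * R 0 / c)" using R_nonneg[of 0] c eta L by simp
        then show ?thesis by linarith
      qed
      finally have k2: "real k \<le> 2 * (R 0 / (c * \<eta>) * (L * R 0 / c))" .
      have "real k \<le> 2 * B"
        unfolding B_def using k1 k2 by (simp only: min_def split: if_split) simp
      moreover have "A \<ge> 0"
        unfolding A_def using ratio mu eta by (intro mult_nonneg_nonneg) auto
      moreover have "real T = real k + real u" using ku by simp
      moreover have "real T \<ge> 2 * (A + B)" using T by (simp only: A_def B_def)
      ultimately have "A \<le> real u" by argo
      then have "- (\<mu> * \<eta>) * real u \<le> - ln ((R 0)\<^sup>2 / \<epsilon>)"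
        using mu eta by (simp add: A_def field_simps)
      then have "exp (- (\<mu> * \<eta>) * real u) \<le> exp (- ln ((R 0)\<^sup>2 / \<epsilon>))" by simp
      also have "\<dots> = \<epsilon> / (R 0)\<^sup>2"
      proof -
        have "(R 0)\<^sup>2 / \<epsilon> > 0" using ratio by linarith
        then show ?thesis by (simp only: exp_minus exp_ln inverse_divide)
      qed
      finally have "exp (- (\<mu> * \<eta>) * real u) * (R 0)\<^sup>2 \<le> \<epsilon> / (R 0)\<^sup>2 * (R 0)\<^sup>2"
        by (rule mult_right_mono) simp
      also have "\<dots> = \<epsilon>" using ratio by auto
      finally show ?thesis using ku by linarith
    qed
  qed
  then show "let R = (\<lambda>t. euclid_norm (clipped_gd d f c \<eta> x0 t - xs)) in
        \<forall>\<epsilon>>0. \<forall>T::nat.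
          real T \<ge> 2 * (1 / (\<mu> * \<eta>) * ln ((R 0)\<^sup>2 / \<epsilon>)
                        + R 0 / (c * \<eta>) * min (sqrt (L / \<mu>)) (L * R 0 / c))
          \<longrightarrow> (R T)\<^sup>2 \<le> \<epsilon>"
    unfolding Let_def R_def by blast
qed simp

end
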